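(* Let $Q$ be a skew symmetric core of order $q$. Then for each integer $m\ge0$ the matrices $\mathcal{J}^{(q)}_m$ and $\mathcal{A}^{(q)}_m$ constructed from $Q$ are a pair of amicable $(\pm1)$-matrices satisfying $$\mathcal{J}^{(q)}_m\left(\mathcal{J}^{(q)}_m\right)^T+q\,\mathcal{A}^{(q)}_m\left(\mathcal{A}^{(q)}_m\right)^T=q^m(q+1)I_{q^m}.$$
   Context: A Hadamard matrix of order $n$ is an $n\times n$ $(\pm1)$-matrix $H$ with $HH^T=nI_n$; it is of skew type if $H=I+W$ with $W$ a skew symmetric $(0,\pm1)$-matrix. A skew symmetric core of order $q$ is a $q\times q$ matrix $Q$ such that $\begin{pmatrix}1 & j\\ -j^T & I+Q\end{pmatrix}$ is a skew type Hadamard matrix of order $q+1$, where $j$ is the $1\times q$ all-ones matrix. Such $Q$ is a skew symmetric $(0,\pm1)$-matrix with $J_qQ=QJ_q=0$ and $QQ^T=qI_q-J_q$, where $J_n$ denotes the $n\times n$ all-ones matrix. Given $Q$, define recursively $\mathcal{J}^{(q)}_0=\mathcal{A}^{(q)}_0=J_1$ and, for $m\ge1$, $\mathcal{J}^{(q)}_m=J_q\otimes\mathcal{A}^{(q)}_{m-1}$, $\mathcal{A}^{(q)}_m=I_q\otimes\mathcal{J}^{(q)}_{m-1}+Q\otimes\mathcal{A}^{(q)}_{m-1}$. Two complex matrices $A,B$ are amicable if $AB^*=BA^*$ (for real matrices, $AB^T=BA^T$). A $(\pm1)$-matrix is a matrix with all entries in $\{1,-1\}$. *)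

theory Defs
  imports "Jordan_Normal_Form.Schur_Decomposition"
begin

definition ones_mat :: "nat \<Rightarrow> nat \<Rightarrow> 'a::one mat" where
  "ones_mat nr nc = mat nr nc (\<lambda>_. 1)"

text \<open>The Kronecker product with the usual block convention: block \<open>(k, l)\<close> of
  \<open>kronecker A B\<close> is \<open>A $$ (k, l)\<close> times \<open>B\<close>.\<close>

definition kronecker :: "'a::times mat \<Rightarrow> 'a mat \<Rightarrow> 'a mat" (infixl "\<otimes>\<^sub>K" 70) where
  "A \<otimes>\<^sub>K B = mat (dim_row A * dim_row B) (dim_col A * dim_col B)
     (\<lambda>(i, j). A $$ (i div dim_row B, j div dim_col B) * B $$ (i mod dim_row B, j mod dim_col B))"

definition pm1_matrix :: "real mat \<Rightarrow> bool" where
  "pm1_matrix A \<longleftrightarrow> elements_mat A \<subseteq> {1, -1}"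

definition skew_symmetric :: "real mat \<Rightarrow> bool" where
  "skew_symmetric A \<longleftrightarrow> square_mat A \<and> A\<^sup>T = - A"

definition hadamard_matrix :: "nat \<Rightarrow> real mat \<Rightarrow> bool" where
  "hadamard_matrix n H \<longleftrightarrow>
     H \<in> carrier_mat n n \<and> pm1_matrix H \<and> H * H\<^sup>T = real n \<cdot>\<^sub>m 1\<^sub>m n"

definition skew_type_hadamard :: "nat \<Rightarrow> real mat \<Rightarrow> bool" where
  "skew_type_hadamard n H \<longleftrightarrow> hadamard_matrix n H \<and>
     (\<exists>W \<in> carrier_mat n n. skew_symmetric W \<and> elements_mat W \<subseteq> {0, 1, -1} \<and> H = 1\<^sub>m n + W)"

definition skew_symmetric_core :: "nat \<Rightarrow> real mat \<Rightarrow> bool" where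
  "skew_symmetric_core q Q \<longleftrightarrow> Q \<in> carrier_mat q q \<and>
     skew_type_hadamard (q + 1)
       (four_block_mat (1\<^sub>m 1) (ones_mat 1 q) (- (ones_mat 1 q)\<^sup>T) (1\<^sub>m q + Q))"

text \<open>For real matrices \<open>mat_adjoint\<close> is the transpose. The dimension condition is what makes
  both products meaningful; the library product is total.\<close>

definition amicable :: "'a::conjugatable_field mat \<Rightarrow> 'a mat \<Rightarrow> bool" where
  "amicable A B \<longleftrightarrow> dim_col A = dim_col B \<and> A * mat_adjoint B = B * mat_adjoint A"

fun seqJ :: "nat \<Rightarrow> real mat \<Rightarrow> nat \<Rightarrow> real mat"
  and seqA :: "nat \<Rightarrow> real mat \<Rightarrow> nat \<Rightarrow> real mat" where
  "seqJ q Q 0 = ones_mat 1 1"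
| "seqA q Q 0 = ones_mat 1 1"
| "seqJ q Q (Suc m) = ones_mat q q \<otimes>\<^sub>K seqA q Q m"
| "seqA q Q (Suc m) = 1\<^sub>m q \<otimes>\<^sub>K seqJ q Q m + Q \<otimes>\<^sub>K seqA q Q m"

end

theory Submission
  imports Defs
begin

(* The core axioms say that Q is skew, JQ = QJ = 0 and QQ^T = qI - J.
   With primes denoting the next step of the recursion, the mixed product rule turns these into
   J'A'^T = J (x) AJ^T and A'J'^T = J (x) JA^T, so amicability is inherited.  In A'A'^T the cross
   terms Q (x) AJ^T and Q^T (x) JA^T cancel by amicability and skewness, and the summand
   -J (x) AA^T coming from QQ^T is what J'J'^T = qJ (x) AA^T compensates in the weighted sum, leaving
   q I (x) (JJ^T + q AA^T). *)

subsection \<open>Kronecker products\<close>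

lemma kronecker_carrier:
  assumes "A \<in> carrier_mat r c" "B \<in> carrier_mat r' c'"
  shows "A \<otimes>\<^sub>K B \<in> carrier_mat (r * r') (c * c')"
  using assms by (auto simp: kronecker_def)

lemma kronecker_index:
  assumes "A \<in> carrier_mat r c" "B \<in> carrier_mat r' c'" "i < r * r'" "j < c * c'"
  shows "(A \<otimes>\<^sub>K B) $$ (i, j) = A $$ (i div r', j div c') * B $$ (i mod r', j mod c')"
  using assms by (auto simp: kronecker_def)

text \<open>The hypothesis forces \<open>b > 0\<close>; without that, \<open>i mod 0 = i\<close>
  would break the bound.\<close>

lemma mod_less_of_less_mult:
  fixes i a b :: nat
  assumes "i < a * b"
  shows "i mod b < b"
  using assms by (cases b) auto

text \<open>Entrywise form of I (x) I = I: a product of a Kronecker delta on blocks and one inside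
  blocks is the delta on the full index.\<close>

lemma eq_iff_div_mod_eq:
  fixes i j n :: nat
  shows "i = j \<longleftrightarrow> i div n = j div n \<and> i mod n = j mod n"
  by (metis div_mult_mod_eq)

lemma kronecker_transpose:
  assumes "A \<in> carrier_mat r c" "B \<in> carrier_mat r' c'"
  shows "(A \<otimes>\<^sub>K B)\<^sup>T = A\<^sup>T \<otimes>\<^sub>K B\<^sup>T"
  using assms
  by (intro eq_matI)
    (auto simp: kronecker_def less_mult_imp_div_less mod_less_of_less_mult)

text \<open>Reindexing by k = x * b + y: the range is cut into \<open>a\<close> consecutive blocks
  of length \<open>b\<close>, and each block is shifted back to start at 0.\<close>

lemma sum_div_mod:
  fixes f :: "nat \<Rightarrow> nat \<Rightarrow> 'a::comm_monoid_add"
  shows "(\<Sum>k<a * b. f (k div b) (k mod b)) = (\<Sum>x<a. \<Sum>y<b. f x y)"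
proof -
  have "(\<Sum>k<a * b. f (k div b) (k mod b))
      = (\<Sum>x<a. \<Sum>k = x * b..<x * b + b. f (k div b) (k mod b))"
    by (rule sum.nat_group[symmetric])
  also have "\<dots> = (\<Sum>x<a. \<Sum>y<b. f x y)"
  proof (rule sum.cong[OF refl])
    fix x
    have "(\<Sum>k = x * b..<x * b + b. f (k div b) (k mod b))
        = (\<Sum>y = 0..<b. f ((y + x * b) div b) ((y + x * b) mod b))"
      using sum.shift_bounds_nat_ivl[of "\<lambda>k. f (k div b) (k mod b)" 0 "x * b" b]
      by (simp add: add.commute)
    also have "\<dots> = (\<Sum>y<b. f x y)"
      by (intro sum.cong) auto
    finally show "(\<Sum>k = x * b..<x * b + b. f (k div b) (k mod b)) = (\<Sum>y<b. f x y)" .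
  qed
  finally show ?thesis .
qed

text \<open>Puts the entry of a product as a sum over \<open>{..<n}\<close>, the shape needed both
  for \<open>sum_div_mod\<close> and for splitting off the border index 0.\<close>

lemma mult_mat_index_sum:
  assumes "A \<in> carrier_mat r n" "B \<in> carrier_mat n c" "i < r" "j < c"
  shows "(A * B) $$ (i, j) = (\<Sum>k<n. A $$ (i, k) * B $$ (k, j))"
  using assms by (auto simp: scalar_prod_def lessThan_atLeast0)

text \<open>Mixed product rule. The summation index over \<open>n * n'\<close> splits into a pair
  (x, y); commutativity moves the entry of \<open>C\<close> past that of \<open>B\<close>, and the
  double sum then factors into the two inner products.\<close>

lemma kronecker_mult:
  fixes A B C D :: "'a::comm_semiring_0 mat"
  assumes A: "A \<in> carrier_mat r n" and B: "B \<in> carrier_mat r' n'"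
    and C: "C \<in> carrier_mat n c" and D: "D \<in> carrier_mat n' c'"
  shows "(A \<otimes>\<^sub>K B) * (C \<otimes>\<^sub>K D) = (A * C) \<otimes>\<^sub>K (B * D)"
proof (rule eq_matI)
  note AC = mult_carrier_mat[OF A C] and BD = mult_carrier_mat[OF B D]
  note AB = kronecker_carrier[OF A B] and CD = kronecker_carrier[OF C D]
  show "dim_row ((A \<otimes>\<^sub>K B) * (C \<otimes>\<^sub>K D)) = dim_row ((A * C) \<otimes>\<^sub>K (B * D))"
    and "dim_col ((A \<otimes>\<^sub>K B) * (C \<otimes>\<^sub>K D)) = dim_col ((A * C) \<otimes>\<^sub>K (B * D))"
    by (simp_all add: kronecker_def)
  fix i j
  assume "i < dim_row ((A * C) \<otimes>\<^sub>K (B * D))" and "j < dim_col ((A * C) \<otimes>\<^sub>K (B * D))"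
  then have i: "i < r * r'" and j: "j < c * c'"
    using A B C D by (auto simp: kronecker_def)
  have bounds: "i div r' < r" "i mod r' < r'" "j div c' < c" "j mod c' < c'"
    using i j by (auto simp: less_mult_imp_div_less mod_less_of_less_mult)
  let ?f = "\<lambda>x y. (A $$ (i div r', x) * C $$ (x, j div c'))
    * (B $$ (i mod r', y) * D $$ (y, j mod c'))"
  have "((A \<otimes>\<^sub>K B) * (C \<otimes>\<^sub>K D)) $$ (i, j)
      = (\<Sum>k<n * n'. (A \<otimes>\<^sub>K B) $$ (i, k) * (C \<otimes>\<^sub>K D) $$ (k, j))"
    by (rule mult_mat_index_sum[OF AB CD i j])
  also have "\<dots> = (\<Sum>k<n * n'. ?f (k div n') (k mod n'))"
    using i j
    by (intro sum.cong) (auto simp: kronecker_index[OF A B] kronecker_index[OF C D] mult_ac)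
  also have "\<dots> = (\<Sum>x<n. \<Sum>y<n'. ?f x y)"
    by (rule sum_div_mod)
  also have "\<dots> = (A * C) $$ (i div r', j div c') * (B * D) $$ (i mod r', j mod c')"
    by (simp only: mult_mat_index_sum[OF A C bounds(1,3)] mult_mat_index_sum[OF B D bounds(2,4)]
        sum_product)
  also have "\<dots> = ((A * C) \<otimes>\<^sub>K (B * D)) $$ (i, j)"
    by (rule kronecker_index[OF AC BD i j, symmetric])
  finally show "((A \<otimes>\<^sub>K B) * (C \<otimes>\<^sub>K D)) $$ (i, j) = ((A * C) \<otimes>\<^sub>K (B * D)) $$ (i, j)" .
qed

subsection \<open>Skew symmetric cores\<close>

lemma ones_mat_carrier [simp]: "ones_mat r c \<in> carrier_mat r c"
  and ones_mat_dim [simp]: "dim_row (ones_mat r c) = r" "dim_col (ones_mat r c) = c"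
  and ones_mat_index [simp]: "i < r \<Longrightarrow> j < c \<Longrightarrow> ones_mat r c $$ (i, j) = 1"
  and ones_mat_transpose [simp]: "(ones_mat r c)\<^sup>T = ones_mat c r"
  by (auto simp: ones_mat_def)

lemma ones_mat_square: "ones_mat n n * ones_mat n n = real n \<cdot>\<^sub>m ones_mat n n"
  by (rule eq_matI) (auto simp: ones_mat_def scalar_prod_def)

lemma pm1_matrix_iff:
  assumes "A \<in> carrier_mat r c"
  shows "pm1_matrix A \<longleftrightarrow> (\<forall>i<r. \<forall>j<c. A $$ (i, j) \<in> {1, -1})"
  using assms unfolding pm1_matrix_def by (force simp: elements_mat_def)

text \<open>Everything is read off the bordered Hadamard matrix \<open>H\<close>: skewness from
  \<open>W\<close>, the off-diagonal signs from the entries of \<open>H\<close>, and the two kinds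
  of product identities from orthogonality of its rows, with or without the border row.\<close>

lemma skew_symmetric_core_properties:
  assumes "skew_symmetric_core q Q"
  shows "Q \<in> carrier_mat q q"
    and "Q\<^sup>T = - Q"
    and "\<And>i. i < q \<Longrightarrow> Q $$ (i, i) = 0"
    and "\<And>i j. i < q \<Longrightarrow> j < q \<Longrightarrow> i \<noteq> j \<Longrightarrow> Q $$ (i, j) \<in> {1, -1}"
    and "Q * ones_mat q q = 0\<^sub>m q q"
    and "ones_mat q q * Q = 0\<^sub>m q q"
    and "Q * Q\<^sup>T = real q \<cdot>\<^sub>m 1\<^sub>m q - ones_mat q q"
proof -
  define H where "H = four_block_mat (1\<^sub>m 1) (ones_mat 1 q) (- (ones_mat 1 q)\<^sup>T) (1\<^sub>m q + Q)"
  have Q: "Q \<in> carrier_mat q q"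
    and "skew_type_hadamard (q + 1) H"
    using assms by (auto simp: skew_symmetric_core_def H_def)
  then obtain W where H: "H \<in> carrier_mat (Suc q) (Suc q)" and pm: "pm1_matrix H"
    and HH: "H * H\<^sup>T = real (Suc q) \<cdot>\<^sub>m 1\<^sub>m (Suc q)"
    and W: "W \<in> carrier_mat (Suc q) (Suc q)" "W\<^sup>T = - W" and HW: "H = 1\<^sub>m (Suc q) + W"
    by (auto simp: skew_type_hadamard_def hadamard_matrix_def skew_symmetric_def)
  \<comment> \<open>The border has index 0, so index \<open>i\<close> of \<open>Q\<close> becomes
    \<open>Suc i\<close> in \<open>H\<close>.\<close>
  have H0: "H $$ (0, 0) = 1" "\<And>j. j < q \<Longrightarrow> H $$ (0, Suc j) = 1"
    and H1: "\<And>i. i < q \<Longrightarrow> H $$ (Suc i, 0) = -1"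
    and H2: "\<And>i j. i < q \<Longrightarrow> j < q \<Longrightarrow> H $$ (Suc i, Suc j) = (if i = j then 1 else 0) + Q $$ (i, j)"
    using Q by (auto simp: H_def ones_mat_def)
  have skew: "Q $$ (j, i) = - Q $$ (i, j)" if "i < q" "j < q" for i j
  proof -
    have "W $$ (Suc j, Suc i) = - W $$ (Suc i, Suc j)"
      using arg_cong[OF W(2), of "\<lambda>M. M $$ (Suc i, Suc j)"] W(1) that by simp
    moreover have "W $$ (Suc i, Suc j) = Q $$ (i, j)" "W $$ (Suc j, Suc i) = Q $$ (j, i)"
      using H2[OF that] H2[OF that(2,1)] W(1) that by (auto simp: HW split: if_splits)
    ultimately show ?thesis by simp
  qed
  show Q': "Q \<in> carrier_mat q q" by fact
  show QT: "Q\<^sup>T = - Q"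
    using Q by (intro eq_matI) (auto intro: skew)
  show diag: "Q $$ (i, i) = 0" if "i < q" for i
    using skew[OF that that] by simp
  show "Q $$ (i, j) \<in> {1, -1}" if "i < q" "j < q" "i \<noteq> j" for i j
  proof -
    have "H $$ (Suc i, Suc j) \<in> {1, -1}"
      using pm that unfolding pm1_matrix_iff[OF H] by blast
    then show ?thesis using H2[OF that(1,2)] that(3) by simp
  qed
  \<comment> \<open>The inner product of two rows of \<open>H\<close>, with the border column split
    off.\<close>
  have inner: "H $$ (i, 0) * H $$ (j, 0) + (\<Sum>k<q. H $$ (i, Suc k) * H $$ (j, Suc k))
      = (if i = j then real (Suc q) else 0)" if "i < Suc q" "j < Suc q" for i j
  proof -
    have "(\<Sum>k<Suc q. H $$ (i, k) * H $$ (j, k)) = (H * H\<^sup>T) $$ (i, j)"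
      using H that by (subst mult_mat_index_sum[of _ "Suc q" "Suc q" _ "Suc q"]) auto
    also have "\<dots> = (if i = j then real (Suc q) else 0)"
      unfolding HH using that by simp
    finally show ?thesis unfolding sum.lessThan_Suc_shift .
  qed
  \<comment> \<open>Orthogonality to the border row: the border entry contributes -1 and the
    identity block contributes 1, so only the row sum of \<open>Q\<close> remains.\<close>
  have row_sum: "(\<Sum>k<q. Q $$ (i, k)) = 0" if "i < q" for i
    using inner[of "Suc i" 0] that by (simp add: H0 H1 H2 sum.distrib)
  show QJ: "Q * ones_mat q q = 0\<^sub>m q q"
    using Q by (intro eq_matI)
      (auto simp: mult_mat_index_sum[OF Q ones_mat_carrier] row_sum simp del: index_mult_mat(1))
  \<comment> \<open>Column sums vanish because transposition turns them into row sums of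
    \<open>Q\<close>, up to sign.\<close>
  have "ones_mat q q * Q = (Q\<^sup>T * ones_mat q q)\<^sup>T"
    using Q by (subst transpose_mult[of _ q q _ q]) auto
  also have "\<dots> = (- (Q * ones_mat q q))\<^sup>T"
    using Q by (simp add: QT)
  also have "\<dots> = 0\<^sub>m q q"
    unfolding QJ by (intro eq_matI) auto
  finally show "ones_mat q q * Q = 0\<^sub>m q q" .
  show "Q * Q\<^sup>T = real q \<cdot>\<^sub>m 1\<^sub>m q - ones_mat q q"
  proof (rule eq_matI)
    fix i j
    assume "i < dim_row (real q \<cdot>\<^sub>m 1\<^sub>m q - ones_mat q q)"
      and "j < dim_col (real q \<cdot>\<^sub>m 1\<^sub>m q - ones_mat q q)"
    then have ij: "i < q" "j < q" by auto
    \<comment> \<open>The leading 1 is the product (-1)(-1) of the border entries. After expansion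
      the two terms linear in \<open>Q\<close> cancel by skewness, leaving the entry of
      \<open>Q Q^T\<close> plus 1 plus the delta.\<close>
    have "1 + (\<Sum>k<q. ((if i = k then 1 else 0) + Q $$ (i, k)) * ((if j = k then 1 else 0) + Q $$ (j, k)))
        = (if i = j then real (Suc q) else 0)"
      using inner[of "Suc i" "Suc j"] ij by (simp add: H1 H2)
    moreover have "(\<Sum>k<q. ((if i = k then 1 else 0) + Q $$ (i, k)) * ((if j = k then 1 else 0) + Q $$ (j, k)))
        = (\<Sum>k<q. (if k = i then (if j = i then 1 else 0) + Q $$ (j, i) else 0)
            + (if k = j then Q $$ (i, j) else 0) + Q $$ (i, k) * Q $$ (j, k))"
      by (intro sum.cong) (auto simp: algebra_simps)
    moreover have "\<dots> = (if i = j then 1 else 0) + Q $$ (j, i) + Q $$ (i, j)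
        + (\<Sum>k<q. Q $$ (i, k) * Q $$ (j, k))"
      using ij by (simp add: sum.distrib)
    moreover have "(Q * Q\<^sup>T) $$ (i, j) = (\<Sum>k<q. Q $$ (i, k) * Q $$ (j, k))"
      using Q ij by (subst mult_mat_index_sum[of _ q q _ q]) auto
    ultimately have "(Q * Q\<^sup>T) $$ (i, j) = (if i = j then real q else 0) - 1"
      using skew[OF ij] by (auto split: if_splits)
    then show "(Q * Q\<^sup>T) $$ (i, j) = (real q \<cdot>\<^sub>m 1\<^sub>m q - ones_mat q q) $$ (i, j)"
      using ij by (simp add: ones_mat_def)
  qed (use Q in \<open>auto simp: ones_mat_def\<close>)
qed

subsection \<open>The recursive construction\<close>

lemma mat_adjoint_real: "mat_adjoint A = (A :: real mat)\<^sup>T"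
  by (rule eq_matI) (auto simp: mat_adjoint_def mat_of_rows_def)

lemma zero_kronecker:
  fixes B :: "'a::semiring_0 mat"
  assumes "B \<in> carrier_mat r' c'"
  shows "0\<^sub>m r c \<otimes>\<^sub>K B = 0\<^sub>m (r * r') (c * c')"
  using assms by (intro eq_matI) (auto simp: kronecker_def less_mult_imp_div_less)

text \<open>One step of the recursion for an arbitrary pair and Gram constant \<open>c\<close>. The
  properties are carried together because amicability of the old pair is used for the new
  amicability and again for the new Gram identity.\<close>

lemma core_recursion_step:
  fixes Q J A :: "real mat"
  assumes core: "skew_symmetric_core q Q"
    and J: "J \<in> carrier_mat n n" and A: "A \<in> carrier_mat n n"
    and pmJ: "pm1_matrix J" and pmA: "pm1_matrix A"
    and amic: "J * A\<^sup>T = A * J\<^sup>T"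
    and gram: "J * J\<^sup>T + real q \<cdot>\<^sub>m (A * A\<^sup>T) = c \<cdot>\<^sub>m 1\<^sub>m n"
  defines "J' \<equiv> ones_mat q q \<otimes>\<^sub>K A" and "A' \<equiv> 1\<^sub>m q \<otimes>\<^sub>K J + Q \<otimes>\<^sub>K A"
  shows "J' \<in> carrier_mat (q * n) (q * n)" "A' \<in> carrier_mat (q * n) (q * n)"
    "pm1_matrix J'" "pm1_matrix A'" "J' * A'\<^sup>T = A' * J'\<^sup>T"
    "J' * J'\<^sup>T + real q \<cdot>\<^sub>m (A' * A'\<^sup>T) = (real q * c) \<cdot>\<^sub>m 1\<^sub>m (q * n)"
proof -
  note Q = skew_symmetric_core_properties[OF core]
  let ?K = "ones_mat q q :: real mat" and ?I = "1\<^sub>m q :: real mat"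
  have K: "?K \<in> carrier_mat q q" and I: "?I \<in> carrier_mat q q" by auto
  have T: "J\<^sup>T \<in> carrier_mat n n" "A\<^sup>T \<in> carrier_mat n n" "Q\<^sup>T \<in> carrier_mat q q"
    using J A Q(1) by auto
  note IJ = kronecker_carrier[OF I J] and QA = kronecker_carrier[OF Q(1) A]
    and IJt = kronecker_carrier[OF I T(1)] and QAt = kronecker_carrier[OF T(3,2)]
  show J': "J' \<in> carrier_mat (q * n) (q * n)"
    unfolding J'_def by (rule kronecker_carrier[OF K A])
  show A': "A' \<in> carrier_mat (q * n) (q * n)"
    unfolding A'_def using IJ QA by simp
  have J't: "J'\<^sup>T = ?K \<otimes>\<^sub>K A\<^sup>T"
    unfolding J'_def by (simp add: kronecker_transpose[OF K A])
  have A't: "A'\<^sup>T = ?I \<otimes>\<^sub>K J\<^sup>T + Q\<^sup>T \<otimes>\<^sub>K A\<^sup>T"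
    unfolding A'_def
    by (simp add: transpose_add[OF IJ QA] kronecker_transpose[OF I J] kronecker_transpose[OF Q(1) A])
  have bounds: "i div n < q" "i mod n < n" if "i < q * n" for i
    using that by (auto simp: less_mult_imp_div_less mod_less_of_less_mult)

  show "pm1_matrix J'"
    unfolding pm1_matrix_iff[OF J']
    using pmA[unfolded pm1_matrix_iff[OF A]] bounds
    by (auto simp: J'_def kronecker_index[OF K A])
  show "pm1_matrix A'"
    unfolding pm1_matrix_iff[OF A']
  proof (intro allI impI)
    fix i j
    assume ij: "i < q * n" "j < q * n"
    \<comment> \<open>The supports of the two summands are complementary: in a diagonal block
      \<open>Q\<close> vanishes and the entry comes from \<open>J\<close>; in any other block the
      identity vanishes and the entry is one of \<open>A\<close> up to sign.\<close>
    have entry: "A' $$ (i, j) = (if i div n = j div n then J $$ (i mod n, j mod n) else 0)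
        + Q $$ (i div n, j div n) * A $$ (i mod n, j mod n)"
      using ij bounds IJ QA
      by (simp add: A'_def kronecker_index[OF I J] kronecker_index[OF Q(1) A])
    have "J $$ (i mod n, j mod n) \<in> {1, -1}" "A $$ (i mod n, j mod n) \<in> {1, -1}"
      using pmJ pmA ij bounds unfolding pm1_matrix_iff[OF J] pm1_matrix_iff[OF A] by blast+
    then show "A' $$ (i, j) \<in> {1, -1}"
      using Q(3)[of "i div n"] Q(4)[of "i div n" "j div n"] ij bounds
      unfolding entry by (cases "i div n = j div n") auto
  qed

  have "?K * Q\<^sup>T = - (?K * Q)"
    unfolding Q(2) by (rule uminus_mult_right_mat) (use Q(1) in \<open>simp add: ones_mat_def\<close>)
  then have KQt: "?K * Q\<^sup>T = 0\<^sub>m q q"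
    unfolding Q(6) by (intro eq_matI) auto
  have AAt: "A * A\<^sup>T \<in> carrier_mat n n" and AJt: "A * J\<^sup>T \<in> carrier_mat n n"
    and JJt: "J * J\<^sup>T \<in> carrier_mat n n" and JAt: "J * A\<^sup>T \<in> carrier_mat n n"
    using J A by auto
  \<comment> \<open>The summand with \<open>Q^T\<close> dies because \<open>?K * Q^T = 0\<close>; in
    the mirrored product below, \<open>Q * ?K = 0\<close> does the same.\<close>
  have "J' * A'\<^sup>T = ?K \<otimes>\<^sub>K (A * J\<^sup>T)"
    unfolding A't
    by (simp add: mult_add_distrib_mat[OF J' IJt QAt])
      (simp add: J'_def kronecker_mult[OF K A I T(1)] kronecker_mult[OF K A T(3,2)] KQt
        zero_kronecker[OF AAt] right_mult_one_mat[OF K] right_add_zero_mat[OF kronecker_carrier[OF K AJt]])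
  moreover have "A' * J'\<^sup>T = ?K \<otimes>\<^sub>K (J * A\<^sup>T)"
    unfolding J't A'_def
    by (simp add: add_mult_distrib_mat[OF IJ QA kronecker_carrier[OF K T(2)]]
        kronecker_mult[OF I J K T(2)] kronecker_mult[OF Q(1) A K T(2)] Q(5)
        zero_kronecker[OF AAt] left_mult_one_mat[OF K] right_add_zero_mat[OF kronecker_carrier[OF K JAt]])
  ultimately show "J' * A'\<^sup>T = A' * J'\<^sup>T"
    by (simp add: amic)

  have JJ: "J' * J'\<^sup>T = (real q \<cdot>\<^sub>m ?K) \<otimes>\<^sub>K (A * A\<^sup>T)"
    unfolding J't by (simp add: J'_def kronecker_mult[OF K A K T(2)] ones_mat_square)
  \<comment> \<open>Here \<open>amic\<close> rewrites the second factor of one cross term, so that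
    both carry \<open>A * J^T\<close> and differ only in \<open>Q\<close> versus
    \<open>Q^T\<close>.\<close>
  have AA: "A' * A'\<^sup>T = (?I \<otimes>\<^sub>K (J * J\<^sup>T) + Q \<otimes>\<^sub>K (A * J\<^sup>T)) + (Q\<^sup>T \<otimes>\<^sub>K (A * J\<^sup>T) + (Q * Q\<^sup>T) \<otimes>\<^sub>K (A * A\<^sup>T))"
    unfolding A't mult_add_distrib_mat[OF A' IJt QAt]
    unfolding A'_def
    by (simp add: add_mult_distrib_mat[OF IJ QA IJt] add_mult_distrib_mat[OF IJ QA QAt]
        kronecker_mult[OF I J I T(1)] kronecker_mult[OF I J T(3,2)]
        kronecker_mult[OF Q(1) A I T(1)] kronecker_mult[OF Q(1) A T(3,2)]
        left_mult_one_mat[OF T(3)] right_mult_one_mat[OF Q(1)] amic)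
  have qK: "real q \<cdot>\<^sub>m ?K \<in> carrier_mat q q" and QQ: "Q * Q\<^sup>T \<in> carrier_mat q q"
    using Q(1) by auto
  note carriers = kronecker_carrier[OF qK AAt] kronecker_carrier[OF I JJt]
    kronecker_carrier[OF Q(1) AJt] kronecker_carrier[OF T(3) AJt] kronecker_carrier[OF QQ AAt]
  show "J' * J'\<^sup>T + real q \<cdot>\<^sub>m (A' * A'\<^sup>T) = (real q * c) \<cdot>\<^sub>m 1\<^sub>m (q * n)"
  \<comment> \<open>Comparing entries turns the remaining cancellation into scalar arithmetic, with
    one block position and one position inside the block.\<close>
  proof (rule eq_matI)
    fix i j
    assume "i < dim_row ((real q * c) \<cdot>\<^sub>m 1\<^sub>m (q * n))" "j < dim_col ((real q * c) \<cdot>\<^sub>m 1\<^sub>m (q * n))"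
    then have ij: "i < q * n" "j < q * n" by auto
    let ?d = "if i div n = j div n then 1 else 0 :: real"
    let ?P = "(J * J\<^sup>T) $$ (i mod n, j mod n)" and ?R = "(A * A\<^sup>T) $$ (i mod n, j mod n)"
    let ?S = "(A * J\<^sup>T) $$ (i mod n, j mod n)" and ?x = "Q $$ (i div n, j div n)"
    note b = bounds[OF ij(1)] bounds[OF ij(2)]
    have "?P + real q * ?R = (J * J\<^sup>T + real q \<cdot>\<^sub>m (A * A\<^sup>T)) $$ (i mod n, j mod n)"
      using b JJt AAt by auto
    also have "\<dots> = (if i mod n = j mod n then c else 0)"
      unfolding gram using b by simp
    finally have PR: "?P + real q * ?R = (if i mod n = j mod n then c else 0)" .
    have "(real q \<cdot>\<^sub>m ?K \<otimes>\<^sub>K (A * A\<^sup>T)) $$ (i, j) = real q * ?R"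
      "(?I \<otimes>\<^sub>K (J * J\<^sup>T)) $$ (i, j) = ?d * ?P"
      "(Q \<otimes>\<^sub>K (A * J\<^sup>T)) $$ (i, j) = ?x * ?S"
      using b by (simp_all only: kronecker_index[OF qK AAt ij] kronecker_index[OF I JJt ij]
          kronecker_index[OF Q(1) AJt ij]) (simp_all add: ones_mat_def)
    moreover have "(Q\<^sup>T \<otimes>\<^sub>K (A * J\<^sup>T)) $$ (i, j) = - ?x * ?S"
      unfolding kronecker_index[OF T(3) AJt ij] using b Q(1) by (simp add: Q(2))
    moreover have "((Q * Q\<^sup>T) \<otimes>\<^sub>K (A * A\<^sup>T)) $$ (i, j) = (real q * ?d - 1) * ?R"
      unfolding kronecker_index[OF QQ AAt ij] unfolding Q(7) using b by simp
    moreover have "(J' * J'\<^sup>T + real q \<cdot>\<^sub>m (A' * A'\<^sup>T)) $$ (i, j)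
        = (real q \<cdot>\<^sub>m ?K \<otimes>\<^sub>K (A * A\<^sup>T)) $$ (i, j) + real q *
          (((?I \<otimes>\<^sub>K (J * J\<^sup>T)) $$ (i, j) + (Q \<otimes>\<^sub>K (A * J\<^sup>T)) $$ (i, j))
           + ((Q\<^sup>T \<otimes>\<^sub>K (A * J\<^sup>T)) $$ (i, j) + ((Q * Q\<^sup>T) \<otimes>\<^sub>K (A * A\<^sup>T)) $$ (i, j)))"
      unfolding JJ AA using ij carriers by simp
    ultimately have "(J' * J'\<^sup>T + real q \<cdot>\<^sub>m (A' * A'\<^sup>T)) $$ (i, j)
        = real q * ?R + real q * ((?d * ?P + ?x * ?S) + (- ?x * ?S + (real q * ?d - 1) * ?R))"
      by (simp only:)
    \<comment> \<open>The terms \<open>?x * ?S\<close> cancel, and the -1 coming from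
      \<open>Q Q^T\<close> removes the leading \<open>real q * ?R\<close>.\<close>
    also have "\<dots> = real q * ?d * (?P + real q * ?R)"
      by (simp add: algebra_simps)
    also have "\<dots> = ((real q * c) \<cdot>\<^sub>m 1\<^sub>m (q * n)) $$ (i, j)"
      unfolding PR using ij eq_iff_div_mod_eq[of i j n] by auto
    finally show "(J' * J'\<^sup>T + real q \<cdot>\<^sub>m (A' * A'\<^sup>T)) $$ (i, j)
        = ((real q * c) \<cdot>\<^sub>m 1\<^sub>m (q * n)) $$ (i, j)" .
  qed (use J' A' in auto)
qed

theorem mainTheorem4:
  fixes q m :: nat and Q :: "real mat"
  assumes "skew_symmetric_core q Q"
  shows "seqJ q Q m \<in> carrier_mat (q ^ m) (q ^ m) \<and>
         seqA q Q m \<in> carrier_mat (q ^ m) (q ^ m) \<and>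
         pm1_matrix (seqJ q Q m) \<and> pm1_matrix (seqA q Q m) \<and>
         amicable (seqJ q Q m) (seqA q Q m) \<and>
         seqJ q Q m * (seqJ q Q m)\<^sup>T + real q \<cdot>\<^sub>m (seqA q Q m * (seqA q Q m)\<^sup>T)
           = real (q ^ m * (q + 1)) \<cdot>\<^sub>m 1\<^sub>m (q ^ m)"
proof (induction m)
  case 0
  have "pm1_matrix (ones_mat 1 1)"
    unfolding pm1_matrix_iff[OF ones_mat_carrier] by simp
  \<comment> \<open>In order 1 the weighted sum is 1 + q; amicability is trivial since the two
    matrices coincide.\<close>
  moreover have "ones_mat 1 1 * (ones_mat 1 1)\<^sup>T + real q \<cdot>\<^sub>m (ones_mat 1 1 * (ones_mat 1 1)\<^sup>T)
      = real (q + 1) \<cdot>\<^sub>m 1\<^sub>m 1"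
    by (rule eq_matI) (auto simp: ones_mat_def scalar_prod_def)
  ultimately show ?case by (simp add: amicable_def)
next
  case (Suc m)
  \<comment> \<open>With c = q^m (q + 1), the new constant q c is the required q^(m+1) (q +
    1).\<close>
  note step = core_recursion_step[OF assms, of "seqJ q Q m" "q ^ m" "seqA q Q m"
      "real (q ^ m * (q + 1))"]
  show ?case
    using step Suc by (auto simp: amicable_def mat_adjoint_real distrib_left mult.assoc)
qed

end
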